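(* Let $X$ and $Y$ be real Banach spaces and let $H$ be a closed subspace of $L(X,Y)$ such that $X^*\otimes Y\subset H$. Assume that $X$ has $BDP$ and $Y^*$ has $w^*$-$BSCSP$. Then $H^*$ has $w^*$-$BSCSP$.
   Context: All Banach spaces are real; $B_Z$, $S_Z$ denote the closed unit ball and unit sphere of $Z$. $L(X,Y)$ is the Banach space of bounded linear operators $X\to Y$ with the operator norm. $X^*\otimes Y\subseteq L(X,Y)$ is the linear span of the rank-one operators $x\mapsto x^*(x)y$, $x^*\in X^*$, $y\in Y$. A slice of $B_Z$ is a set $\{z\in B_Z: z^*(z)>1-\alpha\}$ with $z^*\in S_{Z^*}$, $0<\alpha<1$. A $w^*$-slice of $B_{Z^*}$ is a set $\{f\in B_{Z^*}: f(z)>1-\alpha\}$ with $z\in S_Z$, $0<\alpha<1$. $Z$ has $BDP$ (Ball Dentable Property) if $B_Z$ has slices of arbitrarily small diameter. $Z^*$ has $w^*$-$BSCSP$ ($w^*$-Ball Small Combination of Slice Property) if for every $\varepsilon>0$ there are $w^*$-slices $S_1,\dots,S_n$ of $B_{Z^*}$ and $\lambda_i\ge 0$ with $\sum_{i=1}^n\lambda_i=1$ such that $\sum_{i=1}^n\lambda_iS_i=\{\sum_{i=1}^n\lambda_if_i: f_i\in S_i\}$ has diameter less than $\varepsilon$. The preduals used for $H^*$ and $Y^*$ are $H$ and $Y$. *)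

theory Defs
  imports "HOL-Analysis.Analysis"
begin

section \<open>Slices of the unit ball and BDP\<close>

definition slice :: "('a::real_normed_vector \<Rightarrow>\<^sub>L real) \<Rightarrow> real \<Rightarrow> 'a set" where
  "slice zs \<alpha> = {z \<in> cball 0 1. blinfun_apply zs z > 1 - \<alpha>}"

definition BDP :: "'a::real_normed_vector itself \<Rightarrow> bool" where
  "BDP _ \<longleftrightarrow> (\<forall>\<epsilon>>0. \<exists>(zs :: 'a \<Rightarrow>\<^sub>L real) \<alpha>.
     norm zs = 1 \<and> 0 < \<alpha> \<and> \<alpha> < 1 \<and> diameter (slice zs \<alpha>) < \<epsilon>)"

section \<open>The dual of a subspace\<close>

text \<open>
  For a linear subspace \<open>V\<close> of a normed space, \<open>dual_on V\<close> is the dual Banach space of the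
  normed space \<open>V\<close>. Since \<open>V\<close> is a set and not a type, its functionals are functions on the
  ambient type, normalised to vanish outside \<open>V\<close>, so that each functional on \<open>V\<close> has exactly
  one representative and linear combinations can be formed pointwise.
\<close>

definition dual_on :: "'a::real_normed_vector set \<Rightarrow> ('a \<Rightarrow> real) set" where
  "dual_on V = {f. (\<forall>x. x \<notin> V \<longrightarrow> f x = 0)
     \<and> (\<forall>x\<in>V. \<forall>y\<in>V. f (x + y) = f x + f y)
     \<and> (\<forall>c. \<forall>x\<in>V. f (c *\<^sub>R x) = c * f x)
     \<and> (\<exists>K. \<forall>x\<in>V. \<bar>f x\<bar> \<le> K * norm x)}"

text \<open>As in the library's \<^const>\<open>onorm\<close>, the quotient is \<open>0\<close> at \<open>x = 0\<close>.\<close>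

definition dual_norm :: "'a::real_normed_vector set \<Rightarrow> ('a \<Rightarrow> real) \<Rightarrow> real" where
  "dual_norm V f = (SUP x\<in>V. \<bar>f x\<bar> / norm x)"

definition dual_ball :: "'a::real_normed_vector set \<Rightarrow> ('a \<Rightarrow> real) set" where
  "dual_ball V = {f \<in> dual_on V. dual_norm V f \<le> 1}"

text \<open>The analogue of the library's \<^const>\<open>diameter\<close> for the metric of the dual norm.\<close>

definition dual_diameter :: "'a::real_normed_vector set \<Rightarrow> ('a \<Rightarrow> real) set \<Rightarrow> real" where
  "dual_diameter V A =
     (if A = {} then 0 else SUP (f, g)\<in>A \<times> A. dual_norm V (\<lambda>x. f x - g x))"

section \<open>Weak-star slices and weak-star BSCSP\<close>

definition wstar_slice :: "'a::real_normed_vector set \<Rightarrow> 'a \<Rightarrow> real \<Rightarrow> ('a \<Rightarrow> real) set" where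
  "wstar_slice V z \<alpha> = {f \<in> dual_ball V. f z > 1 - \<alpha>}"

definition is_wstar_slice :: "'a::real_normed_vector set \<Rightarrow> ('a \<Rightarrow> real) set \<Rightarrow> bool" where
  "is_wstar_slice V S \<longleftrightarrow>
     (\<exists>z\<in>V. \<exists>\<alpha>. norm z = 1 \<and> 0 < \<alpha> \<and> \<alpha> < 1 \<and> S = wstar_slice V z \<alpha>)"

definition set_combination ::
    "nat \<Rightarrow> (nat \<Rightarrow> real) \<Rightarrow> (nat \<Rightarrow> ('a \<Rightarrow> real) set) \<Rightarrow> ('a \<Rightarrow> real) set" where
  "set_combination n c S = {(\<lambda>x. \<Sum>i<n. c i * f i x) | f. \<forall>i<n. f i \<in> S i}"

text \<open>
  \<open>dual_wstar_BSCSP V\<close> says that the dual of \<open>V\<close>, with predual \<open>V\<close>, has the weak-star Ball Small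
  Combination of Slice Property. For \<open>V = UNIV\<close> this is the property of the usual dual of the
  whole space, see \<open>dual_wstar_BSCSP_UNIV\<close> below.
\<close>

definition dual_wstar_BSCSP :: "'a::real_normed_vector set \<Rightarrow> bool" where
  "dual_wstar_BSCSP V \<longleftrightarrow> (\<forall>\<epsilon>>0. \<exists>n (S :: nat \<Rightarrow> ('a \<Rightarrow> real) set) c.
     (\<forall>i<n. is_wstar_slice V (S i)) \<and> (\<forall>i<n. 0 \<le> c i) \<and> (\<Sum>i<n. c i) = 1
     \<and> dual_diameter V (set_combination n c S) < \<epsilon>)"

section \<open>The algebraic tensor product\<close>

definition rank_one ::
    "('a::real_normed_vector \<Rightarrow>\<^sub>L real) \<Rightarrow> 'b::real_normed_vector \<Rightarrow> 'a \<Rightarrow>\<^sub>L 'b" where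
  "rank_one xs y = blinfun_scaleR_left y o\<^sub>L xs"

lemma rank_one_apply [simp]: "blinfun_apply (rank_one xs y) x = blinfun_apply xs x *\<^sub>R y"
  by (simp add: rank_one_def)

definition dual_tensor :: "('a::real_normed_vector \<Rightarrow>\<^sub>L 'b::real_normed_vector) set" where
  "dual_tensor = span {rank_one xs y | xs y. True}"

section \<open>The whole space as a subspace of itself\<close>

lemma dual_norm_UNIV: "dual_norm UNIV f = onorm f"
  by (simp add: dual_norm_def onorm_def)

lemma dual_on_UNIV: "dual_on (UNIV :: 'a::real_normed_vector set) = range blinfun_apply"
proof -
  have "f \<in> dual_on UNIV \<longleftrightarrow> bounded_linear f" for f :: "'a \<Rightarrow> real"
  proof
    assume f: "f \<in> dual_on UNIV"
    then obtain K where "\<And>x. \<bar>f x\<bar> \<le> K * norm x"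
      by (auto simp: dual_on_def)
    with f show "bounded_linear f"
      by (intro bounded_linear_intro[of _ K]) (auto simp: dual_on_def mult.commute)
  next
    assume f: "bounded_linear f"
    then interpret bounded_linear f .
    from bounded obtain K where "\<And>x. \<bar>f x\<bar> \<le> norm x * K"
      by auto
    then show "f \<in> dual_on UNIV"
      by (auto simp: dual_on_def add scaleR mult.commute)
  qed
  moreover have "bounded_linear f \<longleftrightarrow> f \<in> range blinfun_apply" for f :: "'a \<Rightarrow> real"
    by (metis blinfun.bounded_linear_right bounded_linear_Blinfun_apply imageE rangeI)
  ultimately show ?thesis
    by blast
qed

lemma dual_ball_UNIV:
  "dual_ball (UNIV :: 'a::real_normed_vector set) = blinfun_apply ` cball 0 1"
  by (auto simp: dual_ball_def dual_on_UNIV dual_norm_UNIV norm_blinfun.rep_eq)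

lemma wstar_slice_UNIV:
  "wstar_slice UNIV z \<alpha> =
     blinfun_apply ` {f :: 'a::real_normed_vector \<Rightarrow>\<^sub>L real. f \<in> cball 0 1 \<and> blinfun_apply f z > 1 - \<alpha>}"
  by (auto simp: wstar_slice_def dual_ball_UNIV)

lemma dual_diameter_UNIV:
  "dual_diameter (UNIV :: 'a::real_normed_vector set) (blinfun_apply ` A) = diameter A"
proof -
  have "dual_norm UNIV (\<lambda>x. blinfun_apply f x - blinfun_apply g x) = dist f g"
    for f g :: "'a \<Rightarrow>\<^sub>L real"
    by (simp add: dual_norm_UNIV dist_norm norm_blinfun.rep_eq minus_blinfun.rep_eq)
  moreover have "blinfun_apply ` A \<times> blinfun_apply ` A
      = map_prod blinfun_apply blinfun_apply ` (A \<times> A)"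
    by (simp add: map_prod_surj_on)
  ultimately show ?thesis
    by (simp add: dual_diameter_def diameter_def image_image case_prod_unfold)
qed

lemma set_combination_UNIV:
  "set_combination n c (\<lambda>i. blinfun_apply ` S i) =
     blinfun_apply ` {(\<Sum>i<n. c i *\<^sub>R f i) | f :: nat \<Rightarrow> 'a::real_normed_vector \<Rightarrow>\<^sub>L real. \<forall>i<n. f i \<in> S i}"
    (is "?L = ?R")
proof
  show "?R \<subseteq> ?L"
    by (force simp: set_combination_def blinfun.sum_left blinfun.scaleR_left)
  show "?L \<subseteq> ?R"
  proof
    fix h assume "h \<in> ?L"
    then obtain f where h: "h = (\<lambda>x. \<Sum>i<n. c i * f i x)"
      and "\<forall>i<n. \<exists>g. f i = blinfun_apply g \<and> g \<in> S i"
      unfolding set_combination_def image_iff by blast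
    then obtain g where g: "\<forall>i<n. f i = blinfun_apply (g i) \<and> g i \<in> S i"
      by metis
    then have "h = blinfun_apply (\<Sum>i<n. c i *\<^sub>R g i)"
      by (auto simp: h blinfun.sum_left blinfun.scaleR_left)
    with g show "h \<in> ?R" by blast
  qed
qed

lemma set_combination_cong:
  "(\<And>i. i < n \<Longrightarrow> S i = T i) \<Longrightarrow> set_combination n c S = set_combination n c T"
  by (simp add: set_combination_def)

theorem dual_wstar_BSCSP_UNIV:
  "dual_wstar_BSCSP (UNIV :: 'a::real_normed_vector set) \<longleftrightarrow>
     (\<forall>\<epsilon>>0. \<exists>n (z :: nat \<Rightarrow> 'a) \<alpha> c.
        (\<forall>i<n. norm (z i) = 1 \<and> 0 < \<alpha> i \<and> \<alpha> i < 1 \<and> 0 \<le> c i) \<and> (\<Sum>i<n. c i) = 1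
        \<and> diameter {(\<Sum>i<n. c i *\<^sub>R f i) | f :: nat \<Rightarrow> 'a \<Rightarrow>\<^sub>L real.
             \<forall>i<n. f i \<in> {f. f \<in> cball 0 1 \<and> blinfun_apply f (z i) > 1 - \<alpha> i}} < \<epsilon>)"
proof -
  let ?T = "\<lambda>z \<alpha> i. {f :: 'a \<Rightarrow>\<^sub>L real. f \<in> cball 0 1 \<and> blinfun_apply f (z i) > 1 - \<alpha> i}"
  have eq: "dual_diameter UNIV (set_combination n c S)
      = diameter {(\<Sum>i<n. c i *\<^sub>R f i) | f. \<forall>i<n. f i \<in> ?T z \<alpha> i}"
    if "\<forall>i<n. S i = wstar_slice UNIV (z i) (\<alpha> i)" for n c S z \<alpha>
  proof -
    have "set_combination n c S = set_combination n c (\<lambda>i. blinfun_apply ` ?T z \<alpha> i)"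
      using that by (intro set_combination_cong) (simp add: wstar_slice_UNIV)
    then show ?thesis
      by (simp only: set_combination_UNIV dual_diameter_UNIV)
  qed
  show ?thesis
    unfolding dual_wstar_BSCSP_def
  proof (intro all_cong1 imp_cong refl iffI)
    fix \<epsilon> :: real
    assume "\<exists>n (S :: nat \<Rightarrow> ('a \<Rightarrow> real) set) c.
      (\<forall>i<n. is_wstar_slice UNIV (S i)) \<and> (\<forall>i<n. 0 \<le> c i) \<and> (\<Sum>i<n. c i) = 1
      \<and> dual_diameter UNIV (set_combination n c S) < \<epsilon>"
    then obtain n S c where *: "\<forall>i<n. is_wstar_slice (UNIV :: 'a set) (S i)" "\<forall>i<n. 0 \<le> c i"
      "(\<Sum>i<n. c i) = 1" "dual_diameter UNIV (set_combination n c S) < \<epsilon>"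
      by blast
    from *(1) have "\<forall>i<n. \<exists>z \<alpha>. norm z = 1 \<and> 0 < \<alpha> \<and> \<alpha> < 1 \<and> S i = wstar_slice UNIV z \<alpha>"
      by (simp add: is_wstar_slice_def)
    then obtain z \<alpha> where z: "\<forall>i<n. norm (z i) = 1 \<and> 0 < \<alpha> i \<and> \<alpha> i < 1
        \<and> S i = wstar_slice UNIV (z i) (\<alpha> i)"
      by metis
    show "\<exists>n (z :: nat \<Rightarrow> 'a) \<alpha> c.
        (\<forall>i<n. norm (z i) = 1 \<and> 0 < \<alpha> i \<and> \<alpha> i < 1 \<and> 0 \<le> c i) \<and> (\<Sum>i<n. c i) = 1
        \<and> diameter {(\<Sum>i<n. c i *\<^sub>R f i) | f. \<forall>i<n. f i \<in> ?T z \<alpha> i} < \<epsilon>"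
      using * z eq[of n S z \<alpha> c]
      by (intro exI[of _ n] exI[of _ z] exI[of _ \<alpha>] exI[of _ c]) simp
  next
    fix \<epsilon> :: real
    assume "\<exists>n (z :: nat \<Rightarrow> 'a) \<alpha> c.
        (\<forall>i<n. norm (z i) = 1 \<and> 0 < \<alpha> i \<and> \<alpha> i < 1 \<and> 0 \<le> c i) \<and> (\<Sum>i<n. c i) = 1
        \<and> diameter {(\<Sum>i<n. c i *\<^sub>R f i) | f. \<forall>i<n. f i \<in> ?T z \<alpha> i} < \<epsilon>"
    then obtain n :: nat and z \<alpha> c where
      *: "\<forall>i<n. norm (z i :: 'a) = 1 \<and> 0 < \<alpha> i \<and> \<alpha> i < 1 \<and> 0 \<le> c i" "(\<Sum>i<n. c i) = 1"
        "diameter {(\<Sum>i<n. c i *\<^sub>R f i) | f. \<forall>i<n. f i \<in> ?T z \<alpha> i} < \<epsilon>"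
      by blast
    let ?S = "\<lambda>i. wstar_slice UNIV (z i) (\<alpha> i)"
    from *(1) have "\<forall>i<n. is_wstar_slice UNIV (?S i)"
      by (auto simp: is_wstar_slice_def)
    with * eq[of n ?S z \<alpha> c]
    show "\<exists>n (S :: nat \<Rightarrow> ('a \<Rightarrow> real) set) c.
      (\<forall>i<n. is_wstar_slice UNIV (S i)) \<and> (\<forall>i<n. 0 \<le> c i) \<and> (\<Sum>i<n. c i) = 1
      \<and> dual_diameter UNIV (set_combination n c S) < \<epsilon>"
      by (intro exI[of _ n] exI[of _ ?S] exI[of _ c]) simp
  qed
qed

end

theory Submission
  imports Defs
begin

text \<open>
  Let \<open>x\<^sup>*\<close> be a norm-one functional defining a slice of \<open>B\<^sub>X\<close> of small diameter, and let \<open>x\<^sub>0\<close> be a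
  point of it. The elements \<open>y\<^sub>i\<close> that define the small combination of slices in \<open>Y\<^sup>*\<close> give
  norm-one operators \<open>x\<^sup>* \<otimes> y\<^sub>i\<close> in \<open>H\<close>, and these define the weak-star slices of the
  unit ball of \<open>H\<^sup>*\<close> that are needed.

  A functional \<open>f\<close> on \<open>H\<close> induces the functional \<open>g y = f (x\<^sup>* \<otimes> y)\<close> on \<open>Y\<close>, and if \<open>f\<close> lies in
  the slice given by \<open>x\<^sup>* \<otimes> y\<^sub>i\<close>, then \<open>g\<close> lies in the slice given by \<open>y\<^sub>i\<close>. The point is that such
  an \<open>f\<close> is almost determined by \<open>g\<close>: for \<open>T\<close> in the unit ball of \<open>H\<close>, \<open>f T\<close> is close to
  \<open>g (T x\<^sub>0)\<close>, uniformly in \<open>T\<close> (\<open>near_norming_functional_factors\<close>). The difference is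
  \<open>f R\<close> with \<open>R = T - x\<^sup>* \<otimes> T x\<^sub>0\<close>. The operator \<open>R\<close> is small on the slice and on its negative,
  whereas on the rest of the ball \<open>x\<^sup>* \<otimes> y\<^sub>i\<close> takes values of norm at most \<open>1 - \<alpha>\<close>, where
  \<open>1 - \<alpha>\<close> is the level that cuts off the slice. Hence adding a small multiple \<open>t R\<close> to \<open>x\<^sup>* \<otimes> y\<^sub>i\<close> barely increases the norm beyond \<open>1\<close> (\<open>norm_perturbed_rank_one\<close>),
  and since \<open>f\<close> is already almost \<open>1\<close> at \<open>x\<^sup>* \<otimes> y\<^sub>i\<close>, it follows that \<open>f R\<close> must be small.

  Consequently a convex combination of functionals \<open>f\<^sub>i\<close> from these slices is, on the unit ball of \<open>H\<close>,
  uniformly close to \<open>T \<mapsto> (\<Sum>\<^sub>i c\<^sub>i g\<^sub>i) (T x\<^sub>0)\<close>, where \<open>\<Sum>\<^sub>i c\<^sub>i g\<^sub>i\<close> ranges over a set of small diameter.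
\<close>

section \<open>Rank-one operators\<close>

lemma rank_one_add: "rank_one xs (y + z) = rank_one xs y + rank_one xs z"
  by (rule blinfun_eqI) (simp add: blinfun.bilinear_simps scaleR_add_right)

lemma rank_one_scaleR: "rank_one xs (c *\<^sub>R y) = c *\<^sub>R rank_one xs y"
  by (rule blinfun_eqI) (simp add: blinfun.bilinear_simps)

lemma rank_one_in_dual_tensor: "rank_one xs y \<in> dual_tensor"
  unfolding dual_tensor_def by (rule span_base) auto

lemma norm_rank_one: "norm (rank_one xs y) = norm xs * norm y"
proof -
  have "onorm (\<lambda>x. blinfun_apply xs x *\<^sub>R y) = onorm (blinfun_apply xs) * norm y"
    by (rule onorm_scaleR_left) (rule blinfun.bounded_linear_right)
  moreover have "blinfun_apply (rank_one xs y) = (\<lambda>x. blinfun_apply xs x *\<^sub>R y)"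
    by (simp add: fun_eq_iff)
  ultimately show ?thesis
    by (simp add: norm_blinfun.rep_eq)
qed

lemma norm_blinfun_le_unit_ball:
  fixes A :: "'a::real_normed_vector \<Rightarrow>\<^sub>L 'b::real_normed_vector"
  assumes "\<And>x. norm x \<le> 1 \<Longrightarrow> norm (blinfun_apply A x) \<le> C"
  shows "norm A \<le> C"
proof (rule norm_blinfun_bound)
  show "0 \<le> C"
    using assms[of 0] by (simp add: blinfun.zero_right)
  show "norm (blinfun_apply A x) \<le> C * norm x" for x
  proof (cases "x = 0")
    case False
    then have "norm (blinfun_apply A (x /\<^sub>R norm x)) \<le> C"
      by (intro assms) simp
    with False show ?thesis
      by (simp add: blinfun.scaleR_right field_simps)
  qed (simp add: blinfun.zero_right)
qed

section \<open>The dual norm of a subspace\<close>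

lemma dual_on_bdd_above:
  assumes "f \<in> dual_on V"
  shows "bdd_above ((\<lambda>x. \<bar>f x\<bar> / norm x) ` V)"
proof -
  obtain K where K: "\<And>x. x \<in> V \<Longrightarrow> \<bar>f x\<bar> \<le> K * norm x"
    using assms unfolding dual_on_def by blast
  have "\<bar>f x\<bar> / norm x \<le> \<bar>K\<bar>" if "x \<in> V" for x
  proof (cases "x = 0")
    case False
    have "\<bar>f x\<bar> \<le> \<bar>K\<bar> * norm x"
      by (rule order_trans[OF K[OF that]]) (intro mult_right_mono; simp)
    with False show ?thesis
      by (simp add: divide_le_eq)
  qed simp
  then show ?thesis
    by (intro bdd_aboveI2)
qed

lemma dual_ball_abs_le:
  assumes "f \<in> dual_ball V" and "x \<in> V"
  shows "\<bar>f x\<bar> \<le> norm x"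
proof (cases "x = 0")
  case True
  with assms show ?thesis
    by (auto simp: dual_ball_def dual_on_def)
next
  case False
  have "\<bar>f x\<bar> / norm x \<le> dual_norm V f"
    unfolding dual_norm_def
    using assms by (intro cSUP_upper dual_on_bdd_above) (auto simp: dual_ball_def)
  also have "\<dots> \<le> 1"
    using assms by (simp add: dual_ball_def)
  finally show ?thesis
    using False by (simp add: divide_le_eq)
qed

lemma dual_on_linear:
  assumes "f \<in> dual_on V"
  shows "x \<in> V \<Longrightarrow> y \<in> V \<Longrightarrow> f (x + y) = f x + f y"
    and "x \<in> V \<Longrightarrow> f (c *\<^sub>R x) = c * f x"
  using assms by (auto simp: dual_on_def)

lemma dual_norm_le:
  assumes "V \<noteq> {}" and "0 \<le> C" and "\<And>x. x \<in> V \<Longrightarrow> \<bar>f x\<bar> \<le> C * norm x"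
  shows "dual_norm V f \<le> C"
  unfolding dual_norm_def
proof (rule cSUP_least[OF assms(1)])
  show "\<bar>f x\<bar> / norm x \<le> C" if "x \<in> V" for x
    using assms(2) assms(3)[OF that] by (cases "x = 0") (auto simp: divide_le_eq)
qed

lemma dual_diameter_le:
  assumes "V \<noteq> {}" and "0 \<le> C"
    and "\<And>f g x. f \<in> A \<Longrightarrow> g \<in> A \<Longrightarrow> x \<in> V \<Longrightarrow> \<bar>f x - g x\<bar> \<le> C * norm x"
  shows "dual_diameter V A \<le> C"
  unfolding dual_diameter_def
  using assms by (auto intro!: cSUP_least dual_norm_le)

section \<open>Functionals that nearly norm a rank-one operator\<close>

text \<open>
  A norm-one functional takes values arbitrarily close to \<open>1\<close> on the ball, so slices have points;
  shrinking \<open>\<alpha>\<close> keeps the diameter small, so the depth of the slice can be taken below \<open>\<delta>\<close> too.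
\<close>
lemma BDP_small_slice:
  assumes "BDP TYPE('a::real_normed_vector)" and "0 < \<delta>"
  obtains xs :: "'a::real_normed_vector \<Rightarrow>\<^sub>L real" and \<alpha> x0
  where "norm xs = 1" "0 < \<alpha>" "\<alpha> < 1" "\<alpha> \<le> \<delta>"
    "norm x0 \<le> 1" "\<And>x. x \<in> slice xs \<alpha> \<Longrightarrow> norm (x - x0) \<le> \<delta>"
proof -
  obtain xs :: "'a \<Rightarrow>\<^sub>L real" and \<alpha>
    where xs: "norm xs = 1" and \<alpha>: "0 < \<alpha>" "\<alpha> < 1" and diam: "diameter (slice xs \<alpha>) < \<delta>"
    using assms unfolding BDP_def by blast
  define \<beta> where "\<beta> = min \<alpha> \<delta>"
  have sub: "slice xs \<beta> \<subseteq> slice xs \<alpha>"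
    by (auto simp: slice_def \<beta>_def)
  have bdd: "bounded (slice xs \<alpha>)"
    by (rule bounded_subset[OF bounded_cball[of 0 1]]) (auto simp: slice_def)
  have "\<exists>x. norm x \<le> 1 \<and> blinfun_apply xs x > 1 - \<beta>"
  proof (rule ccontr)
    assume contra: "\<not> ?thesis"
    have "norm xs \<le> 1 - \<beta>"
    proof (rule norm_blinfun_le_unit_ball)
      fix x :: 'a assume "norm x \<le> 1"
      with contra have "blinfun_apply xs x \<le> 1 - \<beta>" "blinfun_apply xs (- x) \<le> 1 - \<beta>"
        by (metis not_le norm_minus_cancel)+
      then show "norm (blinfun_apply xs x) \<le> 1 - \<beta>"
        by (simp add: blinfun.minus_right abs_le_iff)
    qed
    with xs \<alpha> \<open>0 < \<delta>\<close> show False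
      by (simp add: \<beta>_def)
  qed
  then obtain x0 where x0: "norm x0 \<le> 1" "x0 \<in> slice xs \<beta>"
    by (auto simp: slice_def)
  have "norm (x - x0) \<le> \<delta>" if "x \<in> slice xs \<beta>" for x
    using diameter_bounded_bound[OF bdd, of x x0] that x0 sub diam
    by (force simp: dist_norm)
  then show thesis
    using that[of xs \<beta> x0] xs \<alpha> \<open>0 < \<delta>\<close> x0 by (auto simp: \<beta>_def)
qed

text \<open>
  The slice and the rest of the ball are estimated separately. On the slice \<open>T x\<close> and
  \<open>x\<^sup>*(x) T x\<^sub>0\<close> differ by at most \<open>\<delta> + \<alpha>\<close>, so the perturbation contributes at most \<open>2 t \<delta>\<close>. Where
  \<open>\<bar>x\<^sup>*(x)\<bar> \<le> 1 - \<alpha>\<close>, the perturbation contributes at most \<open>2 t\<close>, which the gap \<open>\<alpha>\<close> absorbs.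
\<close>
lemma norm_perturbed_rank_one:
  fixes T :: "'a::real_normed_vector \<Rightarrow>\<^sub>L 'b::real_normed_vector"
  assumes xs: "norm xs \<le> 1" and x0: "norm x0 \<le> 1" and y: "norm y \<le> 1" and T: "norm T \<le> 1"
    and near: "\<And>x. x \<in> slice xs \<alpha> \<Longrightarrow> norm (x - x0) \<le> \<delta>"
    and \<alpha>: "0 < \<alpha>" "\<alpha> \<le> \<delta>" and t: "0 \<le> t" "2 * t \<le> \<alpha>"
  shows "norm (rank_one xs y + t *\<^sub>R (T - rank_one xs (blinfun_apply T x0))) \<le> 1 + 2 * t * \<delta>"
    (is "norm ?A \<le> ?C")
proof (rule norm_blinfun_le_unit_ball)
  have T_le: "norm (blinfun_apply T x) \<le> norm x" for x
    using norm_blinfun[of T x] mult_right_mono[OF T, of "norm x"] by simp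
  have xs_le: "\<bar>blinfun_apply xs x\<bar> \<le> 1" if "norm x \<le> 1" for x
    using norm_blinfun[of xs x] mult_mono[OF xs that] by simp
  have A: "blinfun_apply ?A x = blinfun_apply xs x *\<^sub>R y
      + t *\<^sub>R (blinfun_apply T x - blinfun_apply xs x *\<^sub>R blinfun_apply T x0)" for x
    by (simp add: blinfun.bilinear_simps)
  have split: "norm (blinfun_apply ?A x) \<le> \<bar>blinfun_apply xs x\<bar> + t * r"
    if "norm (blinfun_apply T x - blinfun_apply xs x *\<^sub>R blinfun_apply T x0) \<le> r" for x r
  proof -
    have "norm (blinfun_apply ?A x) \<le> norm (blinfun_apply xs x *\<^sub>R y)
      + norm (t *\<^sub>R (blinfun_apply T x - blinfun_apply xs x *\<^sub>R blinfun_apply T x0))"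
      unfolding A by (rule norm_triangle_ineq)
    moreover have "norm (blinfun_apply xs x *\<^sub>R y) \<le> \<bar>blinfun_apply xs x\<bar>"
      using y by (simp add: mult_left_le)
    moreover have "norm (t *\<^sub>R (blinfun_apply T x - blinfun_apply xs x *\<^sub>R blinfun_apply T x0))
        \<le> t * r"
      using t that by (simp add: mult_left_mono)
    ultimately show ?thesis by linarith
  qed
  have on_slice: "norm (blinfun_apply ?A x) \<le> ?C"
    if x: "norm x \<le> 1" and large: "blinfun_apply xs x > 1 - \<alpha>" for x
  proof -
    have "blinfun_apply T x - blinfun_apply xs x *\<^sub>R blinfun_apply T x0
        = blinfun_apply T (x - x0) + (1 - blinfun_apply xs x) *\<^sub>R blinfun_apply T x0"
      by (simp add: blinfun.diff_right algebra_simps)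
    also have "norm \<dots> \<le> norm (blinfun_apply T (x - x0))
        + norm ((1 - blinfun_apply xs x) *\<^sub>R blinfun_apply T x0)"
      by (rule norm_triangle_ineq)
    also have "\<dots> \<le> \<delta> + \<alpha>"
    proof (rule add_mono)
      show "norm (blinfun_apply T (x - x0)) \<le> \<delta>"
        using T_le[of "x - x0"] near[of x] x large by (simp add: slice_def)
      have "\<bar>1 - blinfun_apply xs x\<bar> \<le> \<alpha>"
        using xs_le[OF x] large by auto
      moreover have "norm (blinfun_apply T x0) \<le> 1"
        using T_le[of x0] x0 by simp
      ultimately have "\<bar>1 - blinfun_apply xs x\<bar> * norm (blinfun_apply T x0) \<le> \<alpha> * 1"
        using \<alpha> by (intro mult_mono) auto
      then show "norm ((1 - blinfun_apply xs x) *\<^sub>R blinfun_apply T x0) \<le> \<alpha>"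
        by simp
    qed
    finally have "norm (blinfun_apply ?A x) \<le> \<bar>blinfun_apply xs x\<bar> + t * (2 * \<delta>)"
      using \<alpha> by (intro split) auto
    with xs_le[OF x] show ?thesis by simp
  qed
  fix x :: 'a assume x: "norm x \<le> 1"
  consider "blinfun_apply xs x > 1 - \<alpha>" | "blinfun_apply xs (- x) > 1 - \<alpha>"
    | "\<bar>blinfun_apply xs x\<bar> \<le> 1 - \<alpha>"
    by (auto simp: blinfun.minus_right abs_le_iff not_le) linarith
  then show "norm (blinfun_apply ?A x) \<le> ?C"
  proof cases
    case 1
    with x show ?thesis by (rule on_slice)
  next
    case 2
    then have "norm (blinfun_apply ?A (- x)) \<le> ?C"
      using x by (intro on_slice) simp_all
    then show ?thesis
      by (simp only: blinfun.minus_right norm_minus_cancel)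
  next
    case 3
    have "norm (blinfun_apply T x - blinfun_apply xs x *\<^sub>R blinfun_apply T x0)
        \<le> norm (blinfun_apply T x) + \<bar>blinfun_apply xs x\<bar> * norm (blinfun_apply T x0)"
      by (metis norm_scaleR norm_triangle_ineq4)
    also have "\<dots> \<le> 1 + 1 * 1"
      using T_le[of x] T_le[of x0] x x0 xs_le[OF x] by (intro add_mono mult_mono) auto
    finally have "norm (blinfun_apply ?A x) \<le> \<bar>blinfun_apply xs x\<bar> + t * 2"
      by (intro split) simp
    moreover have "0 \<le> t * \<delta>"
      using t \<alpha> by simp
    ultimately show ?thesis
      using 3 t by linarith
  qed
qed

text \<open>
  Evaluating \<open>f\<close> at the perturbed operator bounds \<open>t f(R)\<close> by \<open>2 t \<delta> + \<beta>\<close>, and dividing by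
  \<open>t = \<alpha> / 2\<close> gives \<open>3 \<delta>\<close> as soon as \<open>\<beta> \<le> t \<delta>\<close>. Replacing \<open>T\<close> by \<open>- T\<close> gives the lower bound.
\<close>
lemma near_norming_functional_factors:
  fixes H :: "('a::real_normed_vector \<Rightarrow>\<^sub>L 'b::real_normed_vector) set"
  assumes H: "subspace H" "dual_tensor \<subseteq> H" and f: "f \<in> dual_ball H"
    and xs: "norm xs \<le> 1" and x0: "norm x0 \<le> 1" and y: "norm y \<le> 1"
    and near: "\<And>x. x \<in> slice xs \<alpha> \<Longrightarrow> norm (x - x0) \<le> \<delta>"
    and \<alpha>: "0 < \<alpha>" "\<alpha> \<le> \<delta>" and large: "f (rank_one xs y) \<ge> 1 - \<beta>" and \<beta>: "\<beta> \<le> \<alpha> / 2 * \<delta>"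
    and T: "T \<in> H"
  shows "\<bar>f T - f (rank_one xs (blinfun_apply T x0))\<bar> \<le> 3 * \<delta> * norm T"
proof -
  have r1: "rank_one xs z \<in> H" for z
    using H(2) rank_one_in_dual_tensor by blast
  have f_on: "f \<in> dual_on H"
    using f by (simp add: dual_ball_def)
  note f_add = dual_on_linear(1)[OF f_on] and f_scale = dual_on_linear(2)[OF f_on]
  let ?R = "\<lambda>S. S - rank_one xs (blinfun_apply S x0)"
  let ?t = "\<alpha> / 2"
  have R_in: "?R S \<in> H" if "S \<in> H" for S
    using H(1) that r1 by (rule subspace_diff)
  have f_R: "f (?R S) = f S - f (rank_one xs (blinfun_apply S x0))" if "S \<in> H" for S
    using f_add[OF R_in[OF that] r1, of "blinfun_apply S x0"] by simp
  have upper: "f (?R S) \<le> 3 * \<delta>" if S: "S \<in> H" "norm S \<le> 1" for S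
  proof -
    have tR: "?t *\<^sub>R ?R S \<in> H"
      using H(1) R_in[OF S(1)] by (rule subspace_scale)
    have "f (rank_one xs y) + ?t * f (?R S) = f (rank_one xs y + ?t *\<^sub>R ?R S)"
      using f_add[OF r1 tR, of y] f_scale[OF R_in[OF S(1)], of ?t] by simp
    also have "\<dots> \<le> norm (rank_one xs y + ?t *\<^sub>R ?R S)"
      using dual_ball_abs_le[OF f subspace_add[OF H(1) r1 tR, of y]] by simp
    also have "\<dots> \<le> 1 + 2 * ?t * \<delta>"
      using \<alpha> by (intro norm_perturbed_rank_one[where \<alpha> = \<alpha>] xs x0 y S(2) near) auto
    finally have "?t * f (?R S) \<le> ?t * (3 * \<delta>)"
      using large \<beta> by (simp add: algebra_simps)
    then show ?thesis
      using \<alpha> by simp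
  qed
  have unit: "\<bar>f (?R S)\<bar> \<le> 3 * \<delta>" if S: "S \<in> H" "norm S \<le> 1" for S
  proof -
    have R_minus: "?R (- S) = (- 1) *\<^sub>R ?R S"
      by (rule blinfun_eqI) (simp add: blinfun.bilinear_simps)
    have "f (?R (- S)) = - f (?R S)"
      unfolding R_minus f_scale[OF R_in[OF S(1)]] by simp
    with upper[OF S] upper[of "- S"] S subspace_neg[OF H(1)] show ?thesis
      by auto
  qed
  show ?thesis
  proof (cases "T = 0")
    case True
    then show ?thesis
      using f_scale[OF T, of 0] rank_one_scaleR[of xs 0 "0 :: 'b"] by simp
  next
    case False
    define S where "S = T /\<^sub>R norm T"
    have S: "S \<in> H" "norm S \<le> 1"
      using False subspace_scale[OF H(1) T] by (auto simp: S_def)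
    have T_S: "T = norm T *\<^sub>R S"
      using False by (simp add: S_def)
    have "?R T = norm T *\<^sub>R ?R S"
      by (subst (1 2) T_S)
        (simp add: blinfun.scaleR_left rank_one_scaleR scaleR_diff_right)
    then have "f (?R T) = norm T * f (?R S)"
      using f_scale[OF R_in[OF S(1)]] by simp
    then have "\<bar>f (?R T)\<bar> \<le> norm T * (3 * \<delta>)"
      using unit[OF S] by (simp add: abs_mult mult_left_mono)
    then show ?thesis
      by (simp add: f_R[OF T] mult.commute)
  qed
qed

lemma dual_ball_compose_rank_one:
  fixes H :: "('a::real_normed_vector \<Rightarrow>\<^sub>L 'b::real_normed_vector) set"
  assumes "dual_tensor \<subseteq> H" and f: "f \<in> dual_ball H" and xs: "norm xs \<le> 1"
  shows "(\<lambda>y. f (rank_one xs y)) \<in> dual_ball UNIV"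
proof -
  have r1: "rank_one xs y \<in> H" for y
    using assms(1) rank_one_in_dual_tensor by blast
  have f_on: "f \<in> dual_on H"
    using f by (simp add: dual_ball_def)
  have bound: "\<bar>f (rank_one xs y)\<bar> \<le> 1 * norm y" for y
    using dual_ball_abs_le[OF f r1, of y] mult_right_mono[OF xs, of "norm y"]
    by (simp add: norm_rank_one)
  have "(\<lambda>y. f (rank_one xs y)) \<in> dual_on UNIV"
    unfolding dual_on_def using bound dual_on_linear[OF f_on] r1
    by (auto simp: rank_one_add rank_one_scaleR intro!: exI[of _ 1])
  moreover have "dual_norm UNIV (\<lambda>y. f (rank_one xs y)) \<le> 1"
    using bound by (intro dual_norm_le) auto
  ultimately show ?thesis
    by (simp add: dual_ball_def)
qed

section \<open>Convex combinations of slices\<close>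

text \<open>
  The supremum in the diameter is a bound only for bounded sets; a combination of slices lies in
  the unit ball, where the supremum is finite.
\<close>
lemma set_combination_dual_diameter_bound:
  fixes V :: "'a::real_normed_vector set"
  assumes V: "subspace V" and ball: "\<And>i. i < n \<Longrightarrow> S i \<subseteq> dual_ball V"
    and c: "\<And>i. i < n \<Longrightarrow> 0 \<le> c i" "(\<Sum>i<n. c i) = 1"
    and g: "g \<in> set_combination n c S" and h: "h \<in> set_combination n c S" and x: "x \<in> V"
  shows "\<bar>g x - h x\<bar> \<le> dual_diameter V (set_combination n c S) * norm x"
proof -
  let ?A = "set_combination n c S"
  have abs_le: "\<bar>k z\<bar> \<le> norm z" if k: "k \<in> ?A" and z: "z \<in> V" for k z
  proof -
    obtain f where k_eq: "k = (\<lambda>x. \<Sum>i<n. c i * f i x)" and f: "\<forall>i<n. f i \<in> S i"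
      using k by (auto simp: set_combination_def)
    have "\<bar>k z\<bar> \<le> (\<Sum>i<n. \<bar>c i * f i z\<bar>)"
      unfolding k_eq by (rule sum_abs)
    also have "\<dots> \<le> (\<Sum>i<n. c i * norm z)"
    proof (rule sum_mono)
      fix i assume "i \<in> {..<n}"
      then have "i < n" by simp
      then have "\<bar>f i z\<bar> \<le> norm z"
        using f ball z by (blast intro: dual_ball_abs_le)
      with c(1)[OF \<open>i < n\<close>] show "\<bar>c i * f i z\<bar> \<le> c i * norm z"
        by (simp add: abs_mult mult_left_mono)
    qed
    also have "\<dots> = norm z"
      by (simp add: c(2) flip: sum_distrib_right)
    finally show ?thesis .
  qed
  have diff_le: "\<bar>k z - l z\<bar> \<le> 2 * norm z" if "k \<in> ?A" "l \<in> ?A" "z \<in> V" for k l z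
    using abs_le[of k z] abs_le[of l z] that by auto
  have bdd_A: "bdd_above ((\<lambda>(k, l). dual_norm V (\<lambda>x. k x - l x)) ` (?A \<times> ?A))"
    using diff_le x by (intro bdd_aboveI2[of _ _ 2]) (auto intro!: dual_norm_le)
  have "dual_norm V (\<lambda>x. g x - h x) \<le> dual_diameter V ?A"
    using cSUP_upper[OF _ bdd_A, of "(g, h)"] g h by (auto simp: dual_diameter_def)
  moreover have "\<bar>g x - h x\<bar> / norm x \<le> dual_norm V (\<lambda>x. g x - h x)"
    unfolding dual_norm_def
  proof (rule cSUP_upper[OF x], rule bdd_aboveI2)
    show "\<bar>g z - h z\<bar> / norm z \<le> 2" if "z \<in> V" for z
      using diff_le[OF g h that] by (cases "z = 0") (auto simp: divide_le_eq)
  qed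
  ultimately have "\<bar>g x - h x\<bar> / norm x \<le> dual_diameter V ?A"
    by linarith
  then show ?thesis
    using diff_le[OF g h x] by (cases "x = 0") (auto simp: divide_le_eq)
qed

theorem proposition2p11:
  fixes H :: "('a::banach \<Rightarrow>\<^sub>L 'b::banach) set"
  assumes "subspace H" and "closed H"
    and "dual_tensor \<subseteq> H"
    and "BDP TYPE('a)"
    and "dual_wstar_BSCSP (UNIV :: 'b set)"
  shows "dual_wstar_BSCSP H"
  unfolding dual_wstar_BSCSP_def
proof (intro allI impI)
  fix \<epsilon> :: real assume "0 < \<epsilon>"
  obtain n :: nat and SY :: "nat \<Rightarrow> ('b \<Rightarrow> real) set" and c where
    SY: "\<forall>i<n. is_wstar_slice UNIV (SY i)" and c: "\<forall>i<n. 0 \<le> c i" "(\<Sum>i<n. c i) = 1"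
    and diam: "dual_diameter UNIV (set_combination n c SY) < \<epsilon> / 2"
    using assms(5) \<open>0 < \<epsilon>\<close> unfolding dual_wstar_BSCSP_def by (meson half_gt_zero)
  from SY obtain y a where ya: "\<And>i. i < n \<Longrightarrow> norm (y i :: 'b) = 1 \<and> 0 < a i \<and> a i < 1
      \<and> SY i = wstar_slice UNIV (y i) (a i)"
    unfolding is_wstar_slice_def by metis
  \<comment> \<open>Each of the two functionals to be compared costs \<open>3 * \<delta>\<close>, and \<open>2 * (3 * \<delta>) + \<epsilon> / 2 < \<epsilon>\<close>.\<close>
  define \<delta> where "\<delta> = \<epsilon> / 16"
  have "0 < \<delta>"
    using \<open>0 < \<epsilon>\<close> by (simp add: \<delta>_def)
  obtain xs :: "'a \<Rightarrow>\<^sub>L real" and \<alpha> x0 where xs: "norm xs = 1" and \<alpha>: "0 < \<alpha>" "\<alpha> < 1" "\<alpha> \<le> \<delta>"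
    and x0: "norm x0 \<le> 1" and near: "\<And>x. x \<in> slice xs \<alpha> \<Longrightarrow> norm (x - x0) \<le> \<delta>"
    using BDP_small_slice[OF assms(4) \<open>0 < \<delta>\<close>] by metis
  define b where "b i = min (a i) (\<alpha> / 2 * \<delta>)" for i
  define SH where "SH i = wstar_slice H (rank_one xs (y i)) (b i)" for i
  have "is_wstar_slice H (SH i)" if "i < n" for i
    unfolding is_wstar_slice_def
  proof (intro bexI exI conjI)
    show "SH i = wstar_slice H (rank_one xs (y i)) (b i)"
      by (rule SH_def)
    show "rank_one xs (y i) \<in> H"
      using assms(3) rank_one_in_dual_tensor by blast
  qed (use ya[OF that] xs \<alpha> \<open>0 < \<delta>\<close> in \<open>auto simp: b_def norm_rank_one\<close>)
  moreover have "dual_diameter H (set_combination n c SH) < \<epsilon>"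
  proof -
    let ?D = "dual_diameter UNIV (set_combination n c SY)"
    have induced: "(\<lambda>z. f (rank_one xs z)) \<in> SY i"
      and factor: "T \<in> H \<Longrightarrow> \<bar>f T - f (rank_one xs (blinfun_apply T x0))\<bar> \<le> 3 * \<delta> * norm T"
      if "i < n" "f \<in> SH i" for f i T
    proof -
      have f: "f \<in> dual_ball H" "f (rank_one xs (y i)) > 1 - b i"
        using that by (auto simp: SH_def wstar_slice_def)
      show "(\<lambda>z. f (rank_one xs z)) \<in> SY i"
        using f ya[OF that(1)] dual_ball_compose_rank_one[OF assms(3) f(1)] xs
        by (auto simp: wstar_slice_def b_def)
      show "\<bar>f T - f (rank_one xs (blinfun_apply T x0))\<bar> \<le> 3 * \<delta> * norm T" if "T \<in> H"
        by (rule near_norming_functional_factors[where y = "y i" and \<beta> = "b i" and \<alpha> = \<alpha>])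
          (use assms(1,3) f xs x0 ya[OF \<open>i < n\<close>] near \<alpha> that in \<open>auto simp: b_def\<close>)
    qed
    have approx: "\<exists>k \<in> set_combination n c SY. \<forall>T\<in>H.
        \<bar>h T - k (blinfun_apply T x0)\<bar> \<le> 3 * \<delta> * norm T"
      if "h \<in> set_combination n c SH" for h
    proof -
      obtain f where h: "h = (\<lambda>x. \<Sum>i<n. c i * f i x)" and f: "\<forall>i<n. f i \<in> SH i"
        using \<open>h \<in> set_combination n c SH\<close> by (auto simp: set_combination_def)
      define k where "k z = (\<Sum>i<n. c i * f i (rank_one xs z))" for z
      have "k \<in> set_combination n c SY"
        unfolding set_combination_def k_def[abs_def] using induced f
        by (auto intro!: exI[of _ "\<lambda>i z. f i (rank_one xs z)"])
      moreover have "\<bar>h T - k (blinfun_apply T x0)\<bar> \<le> 3 * \<delta> * norm T" if T: "T \<in> H" for T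
      proof -
        have "\<bar>h T - k (blinfun_apply T x0)\<bar>
            = \<bar>\<Sum>i<n. c i * (f i T - f i (rank_one xs (blinfun_apply T x0)))\<bar>"
          by (simp add: h k_def right_diff_distrib sum_subtractf)
        also have "\<dots> \<le> (\<Sum>i<n. \<bar>c i * (f i T - f i (rank_one xs (blinfun_apply T x0)))\<bar>)"
          by (rule sum_abs)
        also have "\<dots> \<le> (\<Sum>i<n. c i * (3 * \<delta> * norm T))"
          using c(1) f factor T
          by (intro sum_mono) (simp add: abs_mult mult_left_mono del: mult.assoc)
        also have "\<dots> = 3 * \<delta> * norm T"
          using c(2) by (simp flip: sum_distrib_right)
        finally show ?thesis .
      qed
      ultimately show ?thesis by blast
    qed
    have "dual_diameter H (set_combination n c SH) \<le> 6 * \<delta> + \<epsilon> / 2"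
    proof (rule dual_diameter_le)
      show "H \<noteq> {}"
        using subspace_0[OF assms(1)] by blast
      show "0 \<le> 6 * \<delta> + \<epsilon> / 2"
        using \<open>0 < \<epsilon>\<close> \<open>0 < \<delta>\<close> by simp
      fix g h T
      assume gh: "g \<in> set_combination n c SH" "h \<in> set_combination n c SH" and T: "T \<in> H"
      obtain k l where kl: "k \<in> set_combination n c SY" "l \<in> set_combination n c SY"
        and k: "\<bar>g T - k (blinfun_apply T x0)\<bar> \<le> 3 * \<delta> * norm T"
        and l: "\<bar>h T - l (blinfun_apply T x0)\<bar> \<le> 3 * \<delta> * norm T"
        using approx[OF gh(1)] approx[OF gh(2)] T by blast
      have "\<bar>k (blinfun_apply T x0) - l (blinfun_apply T x0)\<bar> \<le> ?D * norm (blinfun_apply T x0)"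
        using ya c kl by (intro set_combination_dual_diameter_bound) (auto simp: wstar_slice_def)
      also have "\<dots> \<le> \<epsilon> / 2 * norm (blinfun_apply T x0)"
        using diam by (intro mult_right_mono) auto
      also have "\<dots> \<le> \<epsilon> / 2 * norm T"
      proof (rule mult_left_mono)
        show "norm (blinfun_apply T x0) \<le> norm T"
          using norm_blinfun[of T x0] mult_left_mono[OF x0, of "norm T"] by simp
      qed (use \<open>0 < \<epsilon>\<close> in simp)
      finally show "\<bar>g T - h T\<bar> \<le> (6 * \<delta> + \<epsilon> / 2) * norm T"
        using k l unfolding distrib_right mult.assoc by linarith
    qed
    also have "\<dots> < \<epsilon>"
      using \<open>0 < \<epsilon>\<close> by (simp add: \<delta>_def)
    finally show ?thesis .
  qed
  ultimately show "\<exists>n S c. (\<forall>i<n. is_wstar_slice H (S i)) \<and> (\<forall>i<n. 0 \<le> c i)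
      \<and> (\<Sum>i<n. c i) = 1 \<and> dual_diameter H (set_combination n c S) < \<epsilon>"
    using c by blast
qed

end
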